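(* Let $\mathcal{S}\subseteq L^2(X)$ be a Hilbert space containing the dictionary $\mathcal{D}=\{g_\lambda:\lambda\in\Lambda\}$, with non-zero greedy factor $\beta>0$, where $\beta^2=\inf_{u\in\mathcal{S},\,\|u\|=1}\ \sup_{\lambda\in\Lambda}\langle g_\lambda,u\rangle^2$. Suppose that $\mathcal{D}$ has non-zero condition number $\mathcal{K}^{-1}$. Let $\Lambda_{\rm d}\subset\Lambda$ be a countable set covering $\Lambda$ with density radius $\rho_{\rm d}=\sup_{\lambda\in\Lambda}\inf_{k\in\Lambda_{\rm d}}d_{\mathcal{G}}(\lambda,k)$, and assume $\rho_{\rm d}<\beta/\sqrt{1+\mathcal{K}}$. Let $\alpha\in(0,1]$. Then there exists a sequence of positive integers $\kappa_m$ such that the geometrically optimized discrete matching pursuit gMP$(\alpha)$ decomposition of functions in $\mathcal{S}$, optimized $\kappa_m$ steps at each iteration $m$, is bounded by the same (exponential) rate of convergence as a continuous matching pursuit cMP$(\alpha'')$ using the continuous dictionary $\mathcal{D}$, i.e. $\|R^{m}f\|\le(1-\alpha''^2\beta^2)^{m/2}\|f\|$, with $$\alpha''=\alpha\,\big(1-\tfrac12\,\beta^{-2}\rho_{\rm d}^2\,(1+\mathcal{K})\big)^{1/2}\ \le\ \alpha .$$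
   Context: Setting. $X$ is a measure space and $L^2(X)$ is the real Hilbert space of square-integrable real functions, with scalar product $\langle\cdot,\cdot\rangle$ and norm $\|\cdot\|$. $\Lambda$ is a continuous parameter space whose elements have $P$ real components $\lambda=(\lambda^0,\dots,\lambda^{P-1})$. For each $\lambda\in\Lambda$ there is an atom $g_\lambda=U(\lambda)g\in L^2(X)$, where $g\in L^2(X)$ is twice differentiable with $\|g\|=1$ and $U(\lambda)$ is isometric, so $\|g_\lambda\|=1$. The atoms $g_\lambda$ are twice differentiable in the components of $\lambda$, with $\partial_{ij}g_\lambda=\partial_{ji}g_\lambda$, $\partial_i=\partial/\partial\lambda^i$. The dictionary is $\mathcal{D}=\{g_\lambda:\lambda\in\Lambda\}$. It is assumed non-degenerate: $\mathcal{G}_{ij}(\lambda)=\langle\partial_ig_\lambda,\partial_jg_\lambda\rangle$ is positive definite, so $(\Lambda,\mathcal{G}_{ij})$ is a Riemannian manifold; $\mathcal{G}^{ij}$ is the inverse of $\mathcal{G}_{ij}$. For $\xi\in T_\lambda\Lambda$, $|\xi|^2=\xi^i\xi^j\mathcal{G}_{ij}(\lambda)$ (summation convention). Geodesics. $d_{\mathcal{G}}(\lambda_a,\lambda_b)=\inf_\gamma\int_0^1\|\frac{d}{dt}g_{\gamma(t)}\|\,dt$ over differentiable curves $\gamma:[0,1]\to\Lambda$ from $\lambda_a$ to $\lambda_b$. It is assumed that a minimizing geodesic exists between any two points of $\Lambda$. Geodesics are parametrized by arc length $s$. Condition number. $\mathcal{K}_\lambda=\sup_{\xi\in T_\lambda\Lambda,\,|\xi|=1}\big\|\frac{d^2}{ds^2}g_{\gamma_\xi(s)}|_{s=0}\big\|$,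 where $\gamma_\xi$ is the unique arc-length geodesic with $\gamma_\xi(0)=\lambda$, $\gamma_\xi'(0)=\xi$. $\mathcal{K}=\sup_{\lambda\in\Lambda}\mathcal{K}_\lambda$. The condition number of $\mathcal{D}$ is $\mathcal{K}^{-1}$ (zero if $\mathcal{K}_\lambda$ is not bounded). Continuous matching pursuit. cMP$(\alpha)$ of $f$ is: $R^0f=f$, $R^{m+1}f=R^mf-\langle g_{\lambda_{m+1}},R^mf\rangle g_{\lambda_{m+1}}$ with $\lambda_{m+1}\in\Lambda$ satisfying $\langle g_{\lambda_{m+1}},R^mf\rangle^2\ge\alpha^2\sup_{\lambda\in\Lambda}\langle g_\lambda,R^mf\rangle^2$. On $\mathcal{S}$ its exponential rate of convergence is the bound $\|R^mf\|\le(1-\alpha^2\beta^2)^{m/2}\|f\|$. It is assumed that for every $u\in L^2(X)$ a maximizer of $\langle g_\lambda,u\rangle^2$ over the dictionary exists. Gradient ascent. For $u\in L^2(X)$ let $S_u(\lambda)=\langle g_\lambda,u\rangle^2$ and $\nabla^iS_u=\mathcal{G}^{ij}\partial_jS_u$. Starting from $k\in\Lambda$, put $\phi_0(k)=k$ and $\phi_{r+1}(k)=\phi_r(k)+t_r\,\xi_r(k)$, where $\xi_r(k)=|\nabla S_u(\phi_r(k))|^{-1}\nabla S_u(\phi_r(k))$ and, at each step, the step size $t_r>0$ is chosen so that $S_u$ is increased; a fixed point $\phi_{r+1}(k)=\phi_r(k)$ is reached if $\nabla S_u(\phi_r(k))=0$. Geometrically optimized discrete matching pursuit. Given a sequence of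 positive integers $\kappa_m$ and $0<\alpha\le1$, gMP$(\alpha)$ of $f$ is: $R^0f=f$, $R^{m+1}f=R^mf-\langle g_{\nu_{m+1}},R^mf\rangle g_{\nu_{m+1}}$, where $g_{\nu_{m+1}}$ is selected in $\{g_{\phi_{\kappa_m}(k)}:k\in\Lambda_{\rm d}\}$ such that $\langle g_{\nu_{m+1}},R^mf\rangle^2\ge\alpha^2\sup_{k\in\Lambda_{\rm d}}\langle g_{\phi_{\kappa_m}(k)},R^mf\rangle^2$, with $\phi_r$ the gradient ascent above for $u=R^mf$. *)

theory Defs
  imports "HOL-Analysis.Analysis"
begin

section \<open>Square-integrable functions\<close>

definition square_integrable :: "'x measure \<Rightarrow> ('x \<Rightarrow> real) set" where
  "square_integrable M = {f \<in> borel_measurable M. integrable M (\<lambda>x. (f x)\<^sup>2)}"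

text \<open>
  \<open>L\<^sup>2(M)\<close> depends on the term \<open>M\<close>, so it cannot be a type constructor. The type \<open>'h\<close> is identified
  with \<open>L\<^sup>2(M)\<close> by a class map \<open>cls\<close>, which sends a square-integrable function to its class.
  Preservation of inner products makes \<open>cls\<close> linear and makes it identify exactly the functions
  that agree almost everywhere.
\<close>
definition is_L2_space :: "'x measure \<Rightarrow> (('x \<Rightarrow> real) \<Rightarrow> 'h::{real_inner, complete_space}) \<Rightarrow> bool" where
  "is_L2_space M cls \<longleftrightarrow>
     (\<forall>f\<in>square_integrable M. \<forall>h\<in>square_integrable M. cls f \<bullet> cls h = (\<integral>x. f x * h x \<partial>M)) \<and>
     cls ` square_integrable M = UNIV"


section \<open>Riemannian geometry of a parametrized dictionary\<close>

text \<open>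
  Parameters are points of an open set \<open>\<Lambda>\<close> of \<open>real^'n\<close>, and a dictionary is given by its
  parametrization \<open>D\<close>, where \<open>D p\<close> is the atom with parameter \<open>p\<close>.
\<close>

definition partial_deriv :: "'n::finite \<Rightarrow> (real^'n \<Rightarrow> 'b::real_normed_vector) \<Rightarrow> real^'n \<Rightarrow> 'b" where
  "partial_deriv i F p = vector_derivative (\<lambda>t. F (p + t *\<^sub>R axis i 1)) (at 0)"

definition twice_differentiable_on :: "(real^'n::finite \<Rightarrow> 'b::real_normed_vector) \<Rightarrow> (real^'n) set \<Rightarrow> bool" where
  "twice_differentiable_on F \<Lambda> \<longleftrightarrow>
     (\<forall>p\<in>\<Lambda>. F differentiable (at p) \<and> (\<forall>i. partial_deriv i F differentiable (at p)))"

definition metric_tensor :: "(real^'n::finite \<Rightarrow> 'h::real_inner) \<Rightarrow> real^'n \<Rightarrow> real^'n^'n" where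
  "metric_tensor D p = (\<chi> i j. partial_deriv i D p \<bullet> partial_deriv j D p)"

definition tangent_norm :: "(real^'n::finite \<Rightarrow> 'h::real_inner) \<Rightarrow> real^'n \<Rightarrow> real^'n \<Rightarrow> real" where
  "tangent_norm D p \<xi> = sqrt (\<Sum>i\<in>UNIV. \<Sum>j\<in>UNIV. \<xi> $ i * \<xi> $ j * metric_tensor D p $ i $ j)"

definition christoffel :: "(real^'n::finite \<Rightarrow> 'h::real_inner) \<Rightarrow> real^'n \<Rightarrow> 'n \<Rightarrow> 'n \<Rightarrow> 'n \<Rightarrow> real" where
  "christoffel D p k i j =
     1/2 * (\<Sum>l\<in>UNIV. matrix_inv (metric_tensor D p) $ k $ l *
       (partial_deriv i (\<lambda>q. metric_tensor D q $ l $ j) p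
        + partial_deriv j (\<lambda>q. metric_tensor D q $ l $ i) p
        - partial_deriv l (\<lambda>q. metric_tensor D q $ i $ j) p))"

definition arc_length_geodesic ::
  "(real^'n::finite \<Rightarrow> 'h::real_inner) \<Rightarrow> (real^'n) set \<Rightarrow> real set \<Rightarrow> (real \<Rightarrow> real^'n) \<Rightarrow> bool" where
  "arc_length_geodesic D \<Lambda> I \<gamma> \<longleftrightarrow>
     \<gamma> ` I \<subseteq> \<Lambda> \<and>
     (\<exists>v a. \<forall>s\<in>I.
        (\<gamma> has_vector_derivative v s) (at s within I) \<and>
        (v has_vector_derivative a s) (at s within I) \<and>
        tangent_norm D (\<gamma> s) (v s) = 1 \<and>
        (\<forall>k. a s $ k + (\<Sum>i\<in>UNIV. \<Sum>j\<in>UNIV. christoffel D (\<gamma> s) k i j * v s $ i * v s $ j) = 0))"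

definition curve_speed :: "(real^'n::finite \<Rightarrow> 'h::real_inner) \<Rightarrow> (real \<Rightarrow> real^'n) \<Rightarrow> real \<Rightarrow> real" where
  "curve_speed D \<gamma> t = norm (vector_derivative (\<lambda>s. D (\<gamma> s)) (at t within {0..1}))"

text \<open>
  Integrability of the speed is required because \<open>integral\<close> is \<open>0\<close> for a function that is not integrable.
\<close>
definition connecting_curves ::
  "(real^'n::finite \<Rightarrow> 'h::real_inner) \<Rightarrow> (real^'n) set \<Rightarrow> real^'n \<Rightarrow> real^'n \<Rightarrow> (real \<Rightarrow> real^'n) set" where
  "connecting_curves D \<Lambda> a b =
     {\<gamma>. \<gamma> differentiable_on {0..1} \<and> \<gamma> ` {0..1} \<subseteq> \<Lambda> \<and> \<gamma> 0 = a \<and> \<gamma> 1 = b \<and>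
         curve_speed D \<gamma> integrable_on {0..1}}"

definition geodesic_dist ::
  "(real^'n::finite \<Rightarrow> 'h::real_inner) \<Rightarrow> (real^'n) set \<Rightarrow> real^'n \<Rightarrow> real^'n \<Rightarrow> ennreal" where
  "geodesic_dist D \<Lambda> a b =
     (INF \<gamma>\<in>connecting_curves D \<Lambda> a b. ennreal (integral {0..1} (curve_speed D \<gamma>)))"

definition minimizing_geodesic ::
  "(real^'n::finite \<Rightarrow> 'h::real_inner) \<Rightarrow> (real^'n) set \<Rightarrow> real^'n \<Rightarrow> real^'n \<Rightarrow> real \<Rightarrow> (real \<Rightarrow> real^'n) \<Rightarrow> bool" where
  "minimizing_geodesic D \<Lambda> a b L \<gamma> \<longleftrightarrow>
     0 \<le> L \<and> arc_length_geodesic D \<Lambda> {0..L} \<gamma> \<and> \<gamma> 0 = a \<and> \<gamma> L = b \<and>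
     ennreal L = geodesic_dist D \<Lambda> a b"

definition second_derivative_at_0 :: "(real \<Rightarrow> 'b::real_normed_vector) \<Rightarrow> 'b" where
  "second_derivative_at_0 c = vector_derivative (\<lambda>s. vector_derivative c (at s)) (at 0)"

text \<open>
  The supremum runs over all unit tangent vectors \<open>\<xi>\<close> at \<open>p\<close> and all germs \<open>\<gamma>\<close> of arc-length
  geodesics with \<open>\<gamma> 0 = p\<close> and initial velocity \<open>\<xi>\<close>. The geodesic equation determines \<open>\<gamma>''(0)\<close>
  from \<open>\<xi>\<close>, so the value does not depend on the choice of \<open>\<gamma>\<close>.
\<close>
definition local_curvature :: "(real^'n::finite \<Rightarrow> 'h::real_inner) \<Rightarrow> (real^'n) set \<Rightarrow> real^'n \<Rightarrow> ennreal" where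
  "local_curvature D \<Lambda> p =
     (SUP (\<xi>, \<gamma>) \<in> {(\<xi>, \<gamma>). tangent_norm D p \<xi> = 1 \<and>
          (\<exists>e>0. arc_length_geodesic D \<Lambda> {-e<..<e} \<gamma>) \<and>
          \<gamma> 0 = p \<and> (\<gamma> has_vector_derivative \<xi>) (at 0)}.
        ennreal (norm (second_derivative_at_0 (\<lambda>s. D (\<gamma> s)))))"

definition max_curvature :: "(real^'n::finite \<Rightarrow> 'h::real_inner) \<Rightarrow> (real^'n) set \<Rightarrow> ennreal" where
  "max_curvature D \<Lambda> = (SUP p\<in>\<Lambda>. local_curvature D \<Lambda> p)"

text \<open>In \<open>ennreal\<close> the inverse of infinity is \<open>0\<close>, as required when the curvature is unbounded.\<close>
definition condition_number :: "(real^'n::finite \<Rightarrow> 'h::real_inner) \<Rightarrow> (real^'n) set \<Rightarrow> ennreal" where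
  "condition_number D \<Lambda> = inverse (max_curvature D \<Lambda>)"

definition density_radius ::
  "(real^'n::finite \<Rightarrow> 'h::real_inner) \<Rightarrow> (real^'n) set \<Rightarrow> (real^'n) set \<Rightarrow> ennreal" where
  "density_radius D \<Lambda> \<Lambda>\<^sub>d = (SUP p\<in>\<Lambda>. INF k\<in>\<Lambda>\<^sub>d. geodesic_dist D \<Lambda> p k)"


section \<open>Matching pursuit\<close>

definition score :: "(real^'n::finite \<Rightarrow> 'h::real_inner) \<Rightarrow> 'h \<Rightarrow> real^'n \<Rightarrow> real" where
  "score D u p = (D p \<bullet> u)\<^sup>2"

definition greedy_factor :: "(real^'n::finite \<Rightarrow> 'h::real_inner) \<Rightarrow> (real^'n) set \<Rightarrow> 'h set \<Rightarrow> real" where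
  "greedy_factor D \<Lambda> S = sqrt (INF u\<in>{u \<in> S. norm u = 1}. SUP p\<in>\<Lambda>. score D u p)"

definition score_gradient :: "(real^'n::finite \<Rightarrow> 'h::real_inner) \<Rightarrow> 'h \<Rightarrow> real^'n \<Rightarrow> real^'n" where
  "score_gradient D u p = matrix_inv (metric_tensor D p) *v (\<chi> j. partial_deriv j (score D u) p)"

text \<open>
  \<open>\<phi> r\<close> is the point reached from \<open>k\<close> after \<open>r\<close> steps. Each step size is arbitrary, provided that the
  step stays in \<open>\<Lambda>\<close> and increases the score.
\<close>
definition gradient_ascent ::
  "(real^'n::finite \<Rightarrow> 'h::real_inner) \<Rightarrow> (real^'n) set \<Rightarrow> 'h \<Rightarrow> real^'n \<Rightarrow> (nat \<Rightarrow> real^'n) \<Rightarrow> bool" where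
  "gradient_ascent D \<Lambda> u k \<phi> \<longleftrightarrow>
     \<phi> 0 = k \<and>
     (\<forall>r. if score_gradient D u (\<phi> r) = 0 then \<phi> (Suc r) = \<phi> r
          else \<exists>t>0. \<phi> (Suc r) =
                 \<phi> r + t *\<^sub>R ((1 / tangent_norm D (\<phi> r) (score_gradient D u (\<phi> r))) *\<^sub>R score_gradient D u (\<phi> r)) \<and>
               \<phi> (Suc r) \<in> \<Lambda> \<and> score D u (\<phi> (Suc r)) > score D u (\<phi> r))"

text \<open>
  \<open>R\<close> is a sequence of residuals of \<open>f\<close> produced by the optimized pursuit; at iteration \<open>m\<close>,
  \<open>\<phi> k\<close> is a gradient ascent for \<open>u = R m\<close> started from \<open>k\<close>.
\<close>
definition gMP ::
  "(real^'n::finite \<Rightarrow> 'h::real_inner) \<Rightarrow> (real^'n) set \<Rightarrow> (real^'n) set \<Rightarrow> (nat \<Rightarrow> nat) \<Rightarrow> real \<Rightarrow> 'h \<Rightarrow> (nat \<Rightarrow> 'h) \<Rightarrow> bool" where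
  "gMP D \<Lambda> \<Lambda>\<^sub>d \<kappa> \<alpha> f R \<longleftrightarrow>
     R 0 = f \<and>
     (\<forall>m. \<exists>\<phi>. (\<forall>k\<in>\<Lambda>\<^sub>d. gradient_ascent D \<Lambda> (R m) k (\<phi> k)) \<and>
        (\<exists>\<nu>\<in>(\<lambda>k. \<phi> k (\<kappa> m)) ` \<Lambda>\<^sub>d.
           (D \<nu> \<bullet> R m)\<^sup>2 \<ge> \<alpha>\<^sup>2 * (SUP k\<in>\<Lambda>\<^sub>d. (D (\<phi> k (\<kappa> m)) \<bullet> R m)\<^sup>2) \<and>
           R (Suc m) = R m - (D \<nu> \<bullet> R m) *\<^sub>R D \<nu>))"

text \<open>
  The rate \<open>(1 - \<alpha>\<^sup>2 \<beta>\<^sup>2)^(m/2)\<close> of a continuous matching pursuit with weakness \<open>\<alpha>\<close>. It is written as a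
  power of a square root because \<open>0 powr 0 = 0\<close> would be wrong for \<open>m = 0\<close> and \<open>\<alpha> = \<beta> = 1\<close>.
\<close>
definition cMP_rate :: "real \<Rightarrow> real \<Rightarrow> nat \<Rightarrow> real" where
  "cMP_rate \<alpha> \<beta> m = sqrt (1 - \<alpha>\<^sup>2 * \<beta>\<^sup>2) ^ m"


section \<open>Parametric dictionaries\<close>

locale parametric_dictionary =
  fixes M :: "'x measure"
    and cls :: "('x \<Rightarrow> real) \<Rightarrow> 'h::{real_inner, complete_space}"
    and \<Lambda> :: "(real^'n::finite) set"
    and U :: "real^'n \<Rightarrow> 'h \<Rightarrow> 'h"
    and g :: 'h
    and atom :: "real^'n \<Rightarrow> 'h"
  assumes L2: "is_L2_space M cls"
    and open_params: "open \<Lambda>"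
    and norm_g: "norm g = 1"
    and isometric: "\<And>p. p \<in> \<Lambda> \<Longrightarrow> linear (U p) \<and> (\<forall>u. norm (U p u) = norm u)"
    and atom_eq: "\<And>p. p \<in> \<Lambda> \<Longrightarrow> atom p = U p g"
    and twice_differentiable: "twice_differentiable_on atom \<Lambda>"
    and partials_commute: "\<And>p i j. p \<in> \<Lambda> \<Longrightarrow>
          partial_deriv i (partial_deriv j atom) p = partial_deriv j (partial_deriv i atom) p"
    and non_degenerate: "\<And>p \<xi>. p \<in> \<Lambda> \<Longrightarrow> \<xi> \<noteq> 0 \<Longrightarrow>
          (\<Sum>i\<in>UNIV. \<Sum>j\<in>UNIV. \<xi> $ i * \<xi> $ j * metric_tensor atom p $ i $ j) > 0"
    and ex_minimizing_geodesic: "\<And>a b. a \<in> \<Lambda> \<Longrightarrow> b \<in> \<Lambda> \<Longrightarrow> a \<noteq> b \<Longrightarrow>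
          \<exists>L \<gamma>. minimizing_geodesic atom \<Lambda> a b L \<gamma>"
    and ex_maximizer: "\<And>u. \<exists>p\<in>\<Lambda>. \<forall>q\<in>\<Lambda>. score atom u q \<le> score atom u p"

end

theory Submission
  imports Defs
begin

text \<open>
  The step sizes of a gradient ascent are such that the score never decreases. Hence whatever the
  number \<open>\<kappa>\<close> of steps, the optimized discrete dictionary scores at least as well as the atoms indexed
  by \<open>\<Lambda>\<^sub>d\<close> itself, and the constant choice \<open>\<kappa> m = 1\<close> suffices. What has to be shown is that the best
  discrete atom is nearly as good as the best atom of the whole dictionary.

  Fix a residual \<open>u\<close> and let \<open>p\<close> maximize \<open>\<lambda> \<mapsto> (g\<^sub>\<lambda> \<bullet> u)\<^sup>2\<close>. Run an arc-length geodesic from \<open>p\<close> to a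
  point \<open>k\<close> of \<open>\<Lambda>\<^sub>d\<close>, put \<open>c(s) = g\<^bsub>\<gamma>(s)\<^esub>\<close> and \<open>h(s) = (c(s) \<bullet> u)\<^sup>2\<close>. Then \<open>h'(0) = 0\<close> because \<open>p\<close> is a
  maximum on the open set \<open>\<Lambda>\<close>, and \<open>h'' = 2 (c' \<bullet> u)\<^sup>2 + 2 (c \<bullet> u) (c'' \<bullet> u)\<close>. Differentiating \<open>c \<bullet> c = 1\<close> twice and
  using \<open>\<parallel>c'\<parallel> = 1\<close> gives \<open>c \<bullet> c'' = -1\<close>. The quadratic form \<open>u \<mapsto> (a \<bullet> u) (b \<bullet> u)\<close> has no eigenvalue below
  \<open>(a \<bullet> b - \<parallel>a\<parallel> \<parallel>b\<parallel>) / 2\<close>, so with \<open>\<parallel>c''\<parallel> \<le> K\<close> one obtains \<open>h'' \<ge> - (1 + K) \<parallel>u\<parallel>\<^sup>2\<close>; this is where the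
  combination \<open>1 + K\<close> comes from. A Taylor estimate now bounds the loss of score between \<open>p\<close> and \<open>k\<close> by
  \<open>(1 + K) L\<^sup>2 \<parallel>u\<parallel>\<^sup>2 / 2\<close>, where \<open>L\<close> is the length of the geodesic (lemma \<open>score_drop_along_geodesic\<close>).

  Since \<open>k\<close> can be chosen with \<open>L\<close> below any number that exceeds the density radius \<open>\<rho>\<close>, and the
  maximal score is at least \<open>\<beta>\<^sup>2 \<parallel>u\<parallel>\<^sup>2\<close>, the best discrete score is at least \<open>(\<beta>\<^sup>2 - (1 + K) \<rho>\<^sup>2 / 2) \<parallel>u\<parallel>\<^sup>2\<close>. Selecting an atom up to the
  factor \<open>\<alpha>\<^sup>2\<close> and subtracting the projection on it multiplies the squared norm of the residual by
  at most \<open>1 - \<alpha>\<^sup>2 (\<beta>\<^sup>2 - (1 + K) \<rho>\<^sup>2 / 2) = 1 - \<alpha>''\<^sup>2 \<beta>\<^sup>2\<close> at every iteration.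
\<close>

section \<open>Two inequalities\<close>

text \<open>
  Only the endpoint derivative and the interior second derivative enter, because a geodesic that is
  given on a closed interval has a two-sided second derivative only at interior points. The slope
  satisfies \<open>f'(t) \<ge> - C t\<close>, and a second integration gives the claim.
\<close>
lemma second_derivative_lower_bound:
  fixes f f' f'' :: "real \<Rightarrow> real"
  assumes "0 \<le> L"
    and f: "\<And>s. s \<in> {0..L} \<Longrightarrow> (f has_real_derivative f' s) (at s within {0..L})"
    and cont: "continuous_on {0..L} f'"
    and f': "\<And>s. 0 < s \<Longrightarrow> s < L \<Longrightarrow> (f' has_real_derivative f'' s) (at s)"
    and lower: "\<And>s. 0 < s \<Longrightarrow> s < L \<Longrightarrow> - C \<le> f'' s"
    and start: "0 \<le> f' 0"
  shows "f 0 - C * L\<^sup>2 / 2 \<le> f L"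
proof -
  have slope: "- C * t \<le> f' t" if t: "0 \<le> t" "t \<le> L" for t
  proof -
    have "f' 0 + C * 0 \<le> f' t + C * t"
    proof (rule DERIV_nonneg_imp_increasing_open[OF t(1)])
      fix s assume "0 < s" "s < t"
      then show "\<exists>y. ((\<lambda>s. f' s + C * s) has_real_derivative y) (at s) \<and> 0 \<le> y"
        using f'[of s] lower[of s] t
        by (intro exI[of _ "f'' s + C"]) (auto intro!: derivative_eq_intros)
    next
      show "continuous_on {0..t} (\<lambda>s. f' s + C * s)"
        using t by (intro continuous_intros continuous_on_subset[OF cont]) auto
    qed
    then show ?thesis using start by simp
  qed
  have "f 0 + C * 0\<^sup>2 / 2 \<le> f L + C * L\<^sup>2 / 2"
  proof (rule DERIV_nonneg_imp_increasing_open[OF \<open>0 \<le> L\<close>])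
    fix s assume s: "0 < s" "s < L"
    then have "(f has_real_derivative f' s) (at s)"
      using f[of s] by (simp add: at_within_Icc_at)
    then show "\<exists>y. ((\<lambda>s. f s + C * s\<^sup>2 / 2) has_real_derivative y) (at s) \<and> 0 \<le> y"
      using slope[of s] s
      by (intro exI[of _ "f' s + C * s"]) (auto intro!: derivative_eq_intros)
  next
    have "continuous_on {0..L} f"
      using f by (meson DERIV_continuous continuous_on_eq_continuous_within)
    then show "continuous_on {0..L} (\<lambda>s. f s + C * s\<^sup>2 / 2)"
      by (intro continuous_intros) auto
  qed
  then show ?thesis by simp
qed

text \<open>
  In dimension at least two the bound is twice the least eigenvalue of \<open>u \<mapsto> (a \<bullet> u) (b \<bullet> u)\<close>. When \<open>a\<close> and \<open>b\<close> have the same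
  norm, it follows from the polarization \<open>4 (a \<bullet> u) (b \<bullet> u) = ((a + b) \<bullet> u)\<^sup>2 - ((a - b) \<bullet> u)\<^sup>2\<close>.
\<close>
lemma inner_product_form_lower_bound:
  fixes a b u :: "'h::real_inner"
  shows "- (norm a * norm b - a \<bullet> b) * (norm u)\<^sup>2 \<le> 2 * ((a \<bullet> u) * (b \<bullet> u))"
proof (cases "a = 0 \<or> b = 0")
  case False
  \<comment> \<open>Scaling each vector by the norm of the other makes the norms equal.\<close>
  define x y where "x = norm b *\<^sub>R a" and "y = norm a *\<^sub>R b"
  define n where "n = norm a * norm b"
  have n: "0 < n" using False by (simp add: n_def)
  have diff: "(norm (x - y))\<^sup>2 = 2 * n * (n - a \<bullet> b)"
  proof -
    have "(norm (x - y))\<^sup>2 = (norm x)\<^sup>2 + (norm y)\<^sup>2 - 2 * (x \<bullet> y)"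
      by (simp add: power2_norm_eq_inner inner_diff inner_commute)
    then show ?thesis
      by (simp add: x_def y_def n_def power2_eq_square algebra_simps)
  qed
  have "((x - y) \<bullet> u)\<^sup>2 \<le> (norm (x - y) * norm u)\<^sup>2"
    using Cauchy_Schwarz_ineq2[of "x - y" u] by (metis abs_ge_zero power2_abs power_mono)
  also have "\<dots> = 2 * n * ((n - a \<bullet> b) * (norm u)\<^sup>2)"
    by (simp add: power_mult_distrib diff)
  finally have "- (2 * n * ((n - a \<bullet> b) * (norm u)\<^sup>2)) \<le> ((x + y) \<bullet> u)\<^sup>2 - ((x - y) \<bullet> u)\<^sup>2"
    using zero_le_power2[of "(x + y) \<bullet> u"] by linarith
  also have "\<dots> = 2 * n * (2 * ((a \<bullet> u) * (b \<bullet> u)))"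
    by (simp add: x_def y_def n_def inner_add inner_diff power2_eq_square algebra_simps)
  finally have "2 * n * (- (n - a \<bullet> b) * (norm u)\<^sup>2) \<le> 2 * n * (2 * ((a \<bullet> u) * (b \<bullet> u)))"
    by (simp add: algebra_simps)
  then have "- (n - a \<bullet> b) * (norm u)\<^sup>2 \<le> 2 * ((a \<bullet> u) * (b \<bullet> u))"
    using n by (subst (asm) mult_le_cancel_left_pos) auto
  then show ?thesis by (simp add: n_def)
qed auto


section \<open>The dictionary along a curve of parameters\<close>

text \<open>
  The differential of \<open>F\<close> at \<open>p\<close>, expanded in the partial derivatives because the metric tensor is
  given by them.
\<close>
definition pushforward :: "(real^'n::finite \<Rightarrow> 'b::real_normed_vector) \<Rightarrow> real^'n \<Rightarrow> real^'n \<Rightarrow> 'b" where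
  "pushforward F p \<xi> = (\<Sum>i\<in>UNIV. \<xi> $ i *\<^sub>R partial_deriv i F p)"

lemma has_derivative_pushforward:
  fixes F :: "real^'n::finite \<Rightarrow> 'b::real_normed_vector"
  assumes "F differentiable (at p)"
  shows "(F has_derivative pushforward F p) (at p)"
proof -
  obtain F' where F': "(F has_derivative F') (at p)"
    using assms by (auto simp: differentiable_def)
  then interpret bounded_linear F' by (rule has_derivative_bounded_linear)
  have partial: "partial_deriv i F p = F' (axis i 1)" for i
  proof -
    have "((\<lambda>t. p + t *\<^sub>R axis i 1) has_derivative (\<lambda>t. t *\<^sub>R axis i 1)) (at (0::real))"
      by (auto intro!: derivative_eq_intros)
    from diff_chain_at[OF this, of F F'] F'
    have "((\<lambda>t. F (p + t *\<^sub>R axis i 1)) has_vector_derivative F' (axis i 1)) (at 0)"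
      by (simp add: has_vector_derivative_def o_def scaleR)
    then show ?thesis
      unfolding partial_deriv_def by (rule vector_derivative_at)
  qed
  have expand: "F' \<xi> = (\<Sum>i\<in>UNIV. \<xi> $ i *\<^sub>R F' (axis i 1))" for \<xi>
  proof -
    have "(\<Sum>i\<in>UNIV. \<xi> $ i *\<^sub>R axis i 1) = \<xi>"
      using basis_expansion[of \<xi>] by (simp add: scalar_mult_eq_scaleR)
    then have "F' \<xi> = F' (\<Sum>i\<in>UNIV. \<xi> $ i *\<^sub>R axis i 1)"
      by (rule arg_cong[OF sym])
    also have "\<dots> = (\<Sum>i\<in>UNIV. \<xi> $ i *\<^sub>R F' (axis i 1))"
      by (simp add: sum scaleR)
    finally show ?thesis .
  qed
  have "F' = pushforward F p"
    by (rule ext) (unfold pushforward_def partial, rule expand)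
  with F' show ?thesis by simp
qed

lemma has_vector_derivative_along_curve:
  fixes F :: "real^'n::finite \<Rightarrow> 'b::real_normed_vector"
  assumes "F differentiable (at (\<gamma> s))" "(\<gamma> has_vector_derivative w) (at s within I)"
  shows "((\<lambda>s. F (\<gamma> s)) has_vector_derivative pushforward F (\<gamma> s) w) (at s within I)"
proof -
  have F: "(F has_derivative pushforward F (\<gamma> s)) (at (\<gamma> s))"
    by (rule has_derivative_pushforward[OF assms(1)])
  have scale: "pushforward F (\<gamma> s) (x *\<^sub>R w) = x *\<^sub>R pushforward F (\<gamma> s) w" for x
    by (rule linear_cmul[OF has_derivative_linear[OF F]])
  have "(F \<circ> \<gamma> has_derivative pushforward F (\<gamma> s) \<circ> (\<lambda>x. x *\<^sub>R w)) (at s within I)"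
    by (rule diff_chain_within[OF assms(2)[unfolded has_vector_derivative_def]])
      (rule has_derivative_at_withinI[OF F])
  then show ?thesis
    by (simp only: has_vector_derivative_def o_def scale)
qed

lemma tangent_norm_eq_norm_pushforward:
  fixes D :: "real^'n::finite \<Rightarrow> 'h::real_inner"
  shows "tangent_norm D p \<xi> = norm (pushforward D p \<xi>)"
proof -
  have scale: "(x *\<^sub>R a) \<bullet> (y *\<^sub>R b) = x * y * (a \<bullet> b)" for x y and a b :: 'h
    by simp
  have "pushforward D p \<xi> \<bullet> pushforward D p \<xi> =
      (\<Sum>i\<in>UNIV. \<Sum>j\<in>UNIV. \<xi> $ i * \<xi> $ j * (partial_deriv i D p \<bullet> partial_deriv j D p))"
    unfolding pushforward_def scale[symmetric]
    by (subst inner_sum_left, subst inner_sum_right) (rule refl)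
  then show ?thesis
    by (simp only: tangent_norm_def norm_eq_sqrt_inner metric_tensor_def vec_lambda_beta)
qed

text \<open>
  The velocity of \<open>D \<circ> \<gamma>\<close> is a sum of products \<open>v\<^sup>i \<partial>\<^sub>i D\<close> of differentiable factors. For a geodesic \<open>\<gamma>\<close> its
  derivative is the acceleration that \<open>local_curvature\<close> measures.
\<close>
lemma curve_twice_differentiable:
  fixes D :: "real^'n::finite \<Rightarrow> 'b::real_normed_vector"
  assumes "twice_differentiable_on D \<Lambda>" "\<gamma> s \<in> \<Lambda>"
    and "(\<gamma> has_vector_derivative v s) (at s within I)"
    and "(v has_vector_derivative a) (at s within I)"
  shows "\<exists>b. ((\<lambda>s. pushforward D (\<gamma> s) (v s)) has_vector_derivative b) (at s within I)"
proof -
  have "\<exists>d. ((\<lambda>s. partial_deriv i D (\<gamma> s)) has_vector_derivative d) (at s within I)" for i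
    using assms(1,2) unfolding twice_differentiable_on_def
    by (intro exI[of _ "pushforward (partial_deriv i D) (\<gamma> s) (v s)"]
        has_vector_derivative_along_curve[OF _ assms(3)]) auto
  then obtain d where d:
    "\<And>i. ((\<lambda>s. partial_deriv i D (\<gamma> s)) has_vector_derivative d i) (at s within I)" by metis
  have v: "((\<lambda>s. v s $ i) has_real_derivative a $ i) (at s within I)" for i
    using bounded_linear.has_vector_derivative[OF bounded_linear_vec_nth assms(4)]
    by (simp add: has_real_derivative_iff_has_vector_derivative)
  show ?thesis unfolding pushforward_def
    by (rule exI, rule has_vector_derivative_sum, rule has_vector_derivative_scaleR[OF v d])
qed

text \<open>
  Every interior point of a geodesic arc carries a two-sided geodesic germ, obtained by shifting the
  parameter; this is the form in which the curvature bound can be applied.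
\<close>
lemma geodesic_acceleration_le_curvature:
  fixes D :: "real^'n::finite \<Rightarrow> 'h::real_inner"
  assumes diff: "twice_differentiable_on D \<Lambda>"
    and image: "\<gamma> ` {0..L} \<subseteq> \<Lambda>"
    and geodesic: "\<And>t. t \<in> {0..L} \<Longrightarrow>
        (\<gamma> has_vector_derivative v t) (at t within {0..L}) \<and>
        (v has_vector_derivative a t) (at t within {0..L}) \<and>
        tangent_norm D (\<gamma> t) (v t) = 1 \<and>
        (\<forall>k. a t $ k + (\<Sum>i\<in>UNIV. \<Sum>j\<in>UNIV. christoffel D (\<gamma> t) k i j * v t $ i * v t $ j) = 0)"
    and s: "0 < s" "s < L"
    and b: "((\<lambda>s. pushforward D (\<gamma> s) (v s)) has_vector_derivative b) (at s)"
  shows "ennreal (norm b) \<le> max_curvature D \<Lambda>"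
proof -
  define \<delta> where "\<delta> t = \<gamma> (s + t)" for t
  define e where "e = min s (L - s)"
  have e: "0 < e" using s by (simp add: e_def)
  have inside: "0 < s + t \<and> s + t < L" if "t \<in> {-e<..<e}" for t
    using that by (auto simp: e_def)
  have shift: "((\<lambda>t. x (s + t)) has_vector_derivative y) (at t within T)"
    if "(x has_vector_derivative y) (at (s + t))" for x :: "real \<Rightarrow> 'c::real_normed_vector" and y t T
  proof -
    have "((\<lambda>t. s + t) has_vector_derivative 1) (at t)"
      by (auto intro!: derivative_eq_intros simp: has_vector_derivative_def)
    from vector_diff_chain_at[OF this that] show ?thesis
      by (auto simp: o_def intro: has_vector_derivative_at_within)
  qed
  have two_sided: "(\<gamma> has_vector_derivative v t) (at t)" "(v has_vector_derivative a t) (at t)"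
    if "0 < t" "t < L" for t
    using geodesic[of t] that by (auto simp: at_within_Icc_at)
  have germ: "arc_length_geodesic D \<Lambda> {-e<..<e} \<delta>"
    unfolding arc_length_geodesic_def
  proof (rule conjI, goal_cases)
    case 1
    show "\<delta> ` {-e<..<e} \<subseteq> \<Lambda>"
      using image inside by (fastforce simp: \<delta>_def)
  next
    case 2
    have "(\<delta> has_vector_derivative v (s + t)) (at t within {-e<..<e}) \<and>
        ((\<lambda>t. v (s + t)) has_vector_derivative a (s + t)) (at t within {-e<..<e}) \<and>
        tangent_norm D (\<delta> t) (v (s + t)) = 1 \<and>
        (\<forall>k. a (s + t) $ k +
          (\<Sum>i\<in>UNIV. \<Sum>j\<in>UNIV. christoffel D (\<delta> t) k i j * v (s + t) $ i * v (s + t) $ j) = 0)"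
      if "t \<in> {-e<..<e}" for t
      using inside[OF that] geodesic[of "s + t"] unfolding \<delta>_def
      by (intro conjI shift two_sided) auto
    then show ?case
      by - (rule exI[of _ "\<lambda>t. v (s + t)"], rule exI[of _ "\<lambda>t. a (s + t)"], blast)
  qed
  have velocity: "vector_derivative (\<lambda>t. D (\<delta> t)) (at t) = pushforward D (\<gamma> (s + t)) (v (s + t))"
    if t: "t \<in> {-e<..<e}" for t
  proof (rule vector_derivative_at, unfold \<delta>_def, rule shift[of "\<lambda>t. D (\<gamma> t)"])
    show "((\<lambda>t. D (\<gamma> t)) has_vector_derivative pushforward D (\<gamma> (s + t)) (v (s + t))) (at (s + t))"
      using inside[OF t] image diff
      by (intro has_vector_derivative_along_curve two_sided)
        (auto simp: twice_differentiable_on_def image_subset_iff)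
  qed
  have "((\<lambda>t. vector_derivative (\<lambda>t. D (\<delta> t)) (at t)) has_vector_derivative b) (at 0)"
  proof (rule has_vector_derivative_transform_within_open[where S = "{-e<..<e}"])
    show "((\<lambda>t. pushforward D (\<gamma> (s + t)) (v (s + t))) has_vector_derivative b) (at 0)"
      using b by (intro shift[of "\<lambda>s. pushforward D (\<gamma> s) (v s)"]) simp
  qed (use e velocity in auto)
  then have "second_derivative_at_0 (\<lambda>t. D (\<delta> t)) = b"
    unfolding second_derivative_at_0_def by (rule vector_derivative_at)
  moreover have "tangent_norm D (\<gamma> s) (v s) = 1" "(\<delta> has_vector_derivative v s) (at 0)"
    using geodesic[of s] s two_sided[of s] shift[of \<gamma> "v s" 0 UNIV] by (auto simp: \<delta>_def[abs_def])
  ultimately have "ennreal (norm b) \<le> local_curvature D \<Lambda> (\<gamma> s)"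
    unfolding local_curvature_def using germ e
    by (intro SUP_upper2[of "(v s, \<delta>)"]) (auto simp: \<delta>_def)
  also have "\<dots> \<le> max_curvature D \<Lambda>"
    unfolding max_curvature_def using image s by (intro SUP_upper) auto
  finally show ?thesis .
qed


section \<open>Loss of score between the best atom and the discrete dictionary\<close>

context parametric_dictionary
begin

lemma norm_atom: "p \<in> \<Lambda> \<Longrightarrow> norm (atom p) = 1"
  using isometric atom_eq norm_g by auto

lemma score_le_norm: "p \<in> \<Lambda> \<Longrightarrow> score atom u p \<le> (norm u)\<^sup>2"
  using Cauchy_Schwarz_ineq2[of "atom p" u] norm_atom[of p] unfolding score_def
  by (metis abs_ge_zero mult_1 power2_abs power_mono)

lemma atom_differentiable: "p \<in> \<Lambda> \<Longrightarrow> atom differentiable (at p)"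
  using twice_differentiable by (simp add: twice_differentiable_on_def)

lemma score_derivative_zero_at_maximizer:
  assumes p: "p \<in> \<Lambda>" and max: "\<And>q. q \<in> \<Lambda> \<Longrightarrow> score atom u q \<le> score atom u p"
  shows "(atom p \<bullet> u) * (pushforward atom p \<xi> \<bullet> u) = 0"
proof -
  have "(score atom u has_derivative
      (\<lambda>\<xi>. 2 * ((atom p \<bullet> u) * (pushforward atom p \<xi> \<bullet> u)))) (at p)"
    unfolding score_def[abs_def] power2_eq_square
    using has_derivative_pushforward[OF atom_differentiable[OF p]]
    by (auto intro!: derivative_eq_intros)
  from differential_zero_maxmin[OF p open_params this] max
  show ?thesis by (metis mult_eq_0_iff zero_neq_numeral)
qed

lemma score_drop_along_geodesic:
  assumes p: "p \<in> \<Lambda>" and max: "\<And>q. q \<in> \<Lambda> \<Longrightarrow> score atom u q \<le> score atom u p"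
    and L: "0 \<le> L" and geodesic: "arc_length_geodesic atom \<Lambda> {0..L} \<gamma>" and start: "\<gamma> 0 = p"
    and K: "max_curvature atom \<Lambda> \<le> ennreal K" "0 \<le> K"
  shows "score atom u p - ((1 + K) * (norm u)\<^sup>2) * L\<^sup>2 / 2 \<le> score atom u (\<gamma> L)"
proof -
  have image: "\<gamma> ` {0..L} \<subseteq> \<Lambda>"
    using geodesic by (simp add: arc_length_geodesic_def)
  from geodesic obtain v a where va: "\<And>s. s \<in> {0..L} \<Longrightarrow>
        (\<gamma> has_vector_derivative v s) (at s within {0..L}) \<and>
        (v has_vector_derivative a s) (at s within {0..L}) \<and>
        tangent_norm atom (\<gamma> s) (v s) = 1 \<and>
        (\<forall>k. a s $ k + (\<Sum>i\<in>UNIV. \<Sum>j\<in>UNIV. christoffel atom (\<gamma> s) k i j * v s $ i * v s $ j) = 0)"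
    unfolding arc_length_geodesic_def by (elim conjE exE) (rule that, erule (1) bspec)
  define c where "c s = atom (\<gamma> s)" for s
  define c' where "c' s = pushforward atom (\<gamma> s) (v s)" for s
  have "\<exists>b. (c' has_vector_derivative b) (at s within {0..L})" if "s \<in> {0..L}" for s
    using curve_twice_differentiable[OF twice_differentiable] va[OF that] image that
    unfolding c'_def[abs_def] by blast
  then obtain c'' where c'':
    "\<And>s. s \<in> {0..L} \<Longrightarrow> (c' has_vector_derivative c'' s) (at s within {0..L})"
    by metis
  have c': "(c has_vector_derivative c' s) (at s within {0..L})" if "s \<in> {0..L}" for s
    unfolding c_def[abs_def] c'_def using va[OF that] image that
    by (intro has_vector_derivative_along_curve atom_differentiable) auto
  have c_unit: "c s \<bullet> c s = 1" and c'_unit: "c' s \<bullet> c' s = 1" if "s \<in> {0..L}" for s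
    using norm_atom[of "\<gamma> s"] va[OF that] image that
    by (auto simp: c_def c'_def tangent_norm_eq_norm_pushforward norm_eq_1 image_subset_iff)
  have inner_deriv: "((\<lambda>s. x s \<bullet> y s) has_real_derivative x s \<bullet> y' + x' \<bullet> y s) (at s within T)"
    if "(x has_vector_derivative x') (at s within T)" "(y has_vector_derivative y') (at s within T)"
    for x y :: "real \<Rightarrow> 'h" and x' y' s T
    unfolding has_field_derivative_def
    by (rule has_derivative_eq_rhs[OF has_derivative_inner[OF that[unfolded has_vector_derivative_def]]])
      (simp add: fun_eq_iff algebra_simps)
  have interior: "(c has_vector_derivative c' s) (at s)" "(c' has_vector_derivative c'' s) (at s)"
    if "0 < s" "s < L" for s
    using c'[of s] c''[of s] that by (auto simp: at_within_Icc_at)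
  have orth: "c s \<bullet> c' s = 0" if s: "0 < s" "s < L" for s
  proof -
    have "((\<lambda>s. c s \<bullet> c s) has_real_derivative c s \<bullet> c' s + c' s \<bullet> c s) (at s)"
      using interior[OF s] by (intro inner_deriv)
    moreover have "((\<lambda>s. c s \<bullet> c s) has_real_derivative 0) (at s)"
      by (rule has_field_derivative_transform_within_open[OF DERIV_const, where S = "{0<..<L}"])
        (use c_unit s in auto)
    ultimately show ?thesis
      using DERIV_unique by (fastforce simp: inner_commute)
  qed
  have normal: "c s \<bullet> c'' s = -1" if s: "0 < s" "s < L" for s
  proof -
    have "((\<lambda>s. c s \<bullet> c' s) has_real_derivative c s \<bullet> c'' s + c' s \<bullet> c' s) (at s)"
      using interior[OF s] by (intro inner_deriv)
    moreover have "((\<lambda>s. c s \<bullet> c' s) has_real_derivative 0) (at s)"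
      by (rule has_field_derivative_transform_within_open[OF DERIV_const, where S = "{0<..<L}"])
        (use orth s in auto)
    ultimately show ?thesis
      using DERIV_unique c'_unit[of s] s by fastforce
  qed
  define h' where "h' s = 2 * ((c s \<bullet> u) * (c' s \<bullet> u))" for s
  define h'' where "h'' s = 2 * ((c' s \<bullet> u)\<^sup>2 + (c s \<bullet> u) * (c'' s \<bullet> u))" for s
  have cu: "((\<lambda>s. c s \<bullet> u) has_real_derivative c' s \<bullet> u) (at s within {0..L})"
    and c'u: "((\<lambda>s. c' s \<bullet> u) has_real_derivative c'' s \<bullet> u) (at s within {0..L})"
    if "s \<in> {0..L}" for s
    using inner_deriv[OF c'[OF that] has_vector_derivative_const]
      inner_deriv[OF c''[OF that] has_vector_derivative_const] by auto
  have h'': "(h' has_real_derivative h'' s) (at s within {0..L})" if "s \<in> {0..L}" for s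
    unfolding h'_def[abs_def] h''_def
    by (rule derivative_eq_intros cu[OF that] c'u[OF that] refl)+ (simp add: power2_eq_square)
  have "(c 0 \<bullet> u)\<^sup>2 - ((1 + K) * (norm u)\<^sup>2) * L\<^sup>2 / 2 \<le> (c L \<bullet> u)\<^sup>2"
  proof (rule second_derivative_lower_bound[OF L])
    show "((\<lambda>s. (c s \<bullet> u)\<^sup>2) has_real_derivative h' s) (at s within {0..L})" if "s \<in> {0..L}" for s
      unfolding h'_def by (rule derivative_eq_intros cu[OF that] refl)+ simp
    show "continuous_on {0..L} h'"
      using h'' by (meson DERIV_continuous continuous_on_eq_continuous_within)
    show "(h' has_real_derivative h'' s) (at s)" if "0 < s" "s < L" for s
      using h''[of s] that by (simp add: at_within_Icc_at)
    show "- ((1 + K) * (norm u)\<^sup>2) \<le> h'' s" if s: "0 < s" "s < L" for s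
    proof -
      have "ennreal (norm (c'' s)) \<le> max_curvature atom \<Lambda>"
        using geodesic_acceleration_le_curvature[OF twice_differentiable image va s] interior(2)[OF s]
        unfolding c'_def[abs_def] by blast
      with K have "norm (c'' s) \<le> K"
        by (meson ennreal_le_iff order_trans)
      moreover have "norm (c s) = 1"
        using c_unit[of s] s by (simp add: norm_eq_1)
      ultimately have "norm (c s) * norm (c'' s) - c s \<bullet> c'' s \<le> 1 + K"
        using normal[OF s] by simp
      then have "- ((1 + K) * (norm u)\<^sup>2) \<le> - (norm (c s) * norm (c'' s) - c s \<bullet> c'' s) * (norm u)\<^sup>2"
        by (simp only: mult_minus_left neg_le_iff_le mult_right_mono zero_le_power2)
      also have "\<dots> \<le> 2 * ((c s \<bullet> u) * (c'' s \<bullet> u))"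
        by (rule inner_product_form_lower_bound)
      also have "\<dots> \<le> h'' s" by (simp add: h''_def)
      finally show ?thesis .
    qed
    show "0 \<le> h' 0"
      using score_derivative_zero_at_maximizer[OF p max, of "v 0"] start
      by (auto simp: h'_def c_def c'_def)
  qed
  then show ?thesis by (simp add: score_def c_def start)
qed

text \<open>
  The infimum of the distances to \<open>\<Lambda>\<^sub>d\<close> need not be attained, so the estimate is first obtained for every
  radius \<open>r > \<rho>\<close>, and the supremum on the left absorbs the passage to the limit.
\<close>
lemma discrete_score_lower_bound:
  assumes sub: "\<Lambda>\<^sub>d \<subseteq> \<Lambda>"
    and dense: "density_radius atom \<Lambda> \<Lambda>\<^sub>d \<le> ennreal \<rho>" and \<rho>: "0 \<le> \<rho>"
    and K: "max_curvature atom \<Lambda> \<le> ennreal K" "0 \<le> K"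
  shows "(SUP p\<in>\<Lambda>. score atom u p) - (1 + K) * (norm u)\<^sup>2 * \<rho>\<^sup>2 / 2 \<le> (SUP k\<in>\<Lambda>\<^sub>d. score atom u k)"
proof -
  obtain p where p: "p \<in> \<Lambda>" and max: "\<And>q. q \<in> \<Lambda> \<Longrightarrow> score atom u q \<le> score atom u p"
    using ex_maximizer by blast
  have sup: "(SUP q\<in>\<Lambda>. score atom u q) = score atom u p"
    using p max by (intro cSup_eq_maximum) auto
  have bdd: "bdd_above (score atom u ` \<Lambda>\<^sub>d)"
    using sub score_le_norm by (auto intro!: bdd_aboveI[of _ "(norm u)\<^sup>2"])
  have radius: "score atom u p - (1 + K) * (norm u)\<^sup>2 * r\<^sup>2 / 2 \<le> (SUP k\<in>\<Lambda>\<^sub>d. score atom u k)"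
    if r: "\<rho> < r" for r
  proof -
    have "(INF k\<in>\<Lambda>\<^sub>d. geodesic_dist atom \<Lambda> p k) \<le> density_radius atom \<Lambda> \<Lambda>\<^sub>d"
      unfolding density_radius_def using p by (intro SUP_upper)
    also have "\<dots> < ennreal r"
      using dense r \<rho> by (meson ennreal_less_iff le_less_trans)
    finally obtain k where k: "k \<in> \<Lambda>\<^sub>d" "geodesic_dist atom \<Lambda> p k < ennreal r"
      by (auto simp: INF_less_iff)
    have "score atom u p - (1 + K) * (norm u)\<^sup>2 * r\<^sup>2 / 2 \<le> score atom u k"
    proof (cases "p = k")
      case True
      then show ?thesis using K by simp
    next
      case False
      then obtain L \<gamma> where \<gamma>: "minimizing_geodesic atom \<Lambda> p k L \<gamma>"
        using ex_minimizing_geodesic[of p k] p k sub by blast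
      then have "0 \<le> L" "ennreal L < ennreal r"
        using k(2) by (simp_all add: minimizing_geodesic_def)
      then have L: "0 \<le> L" "L \<le> r"
        by (simp_all add: ennreal_less_iff)
      have "(1 + K) * (norm u)\<^sup>2 * L\<^sup>2 \<le> (1 + K) * (norm u)\<^sup>2 * r\<^sup>2"
        using L K by (intro mult_left_mono power_mono) auto
      moreover have "score atom u p - (1 + K) * (norm u)\<^sup>2 * L\<^sup>2 / 2 \<le> score atom u (\<gamma> L)"
        using \<gamma> unfolding minimizing_geodesic_def
        by (intro score_drop_along_geodesic p max K) auto
      ultimately show ?thesis
        using \<gamma> by (simp add: minimizing_geodesic_def)
    qed
    also have "\<dots> \<le> (SUP k\<in>\<Lambda>\<^sub>d. score atom u k)"
      using k(1) bdd by (intro cSUP_upper)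
    finally show ?thesis .
  qed
  have "((\<lambda>r. score atom u p - (1 + K) * (norm u)\<^sup>2 * r\<^sup>2 / 2) \<longlongrightarrow>
      score atom u p - (1 + K) * (norm u)\<^sup>2 * \<rho>\<^sup>2 / 2) (at_right \<rho>)"
    by (intro tendsto_intros) simp
  moreover have "\<forall>\<^sub>F r in at_right \<rho>. score atom u p - (1 + K) * (norm u)\<^sup>2 * r\<^sup>2 / 2
      \<le> (SUP k\<in>\<Lambda>\<^sub>d. score atom u k)"
    using radius by (auto simp: eventually_at_filter)
  ultimately show ?thesis
    unfolding sup by (intro tendsto_upperbound) auto
qed

text \<open>
  The infimum over unit vectors extends to all of \<open>S\<close> by homogeneity of the score in \<open>u\<close>. Positivity
  of the greedy factor ensures that its square is that infimum.
\<close>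
lemma greedy_factor_bound:
  assumes "subspace S" "u \<in> S" "0 < greedy_factor atom \<Lambda> S"
  shows "(greedy_factor atom \<Lambda> S)\<^sup>2 * (norm u)\<^sup>2 \<le> (SUP p\<in>\<Lambda>. score atom u p)"
proof -
  obtain p where p: "p \<in> \<Lambda>" and max: "\<And>q. q \<in> \<Lambda> \<Longrightarrow> score atom u q \<le> score atom u p"
    using ex_maximizer by blast
  have sup: "(SUP q\<in>\<Lambda>. score atom u q) = score atom u p"
    using p max by (intro cSup_eq_maximum) auto
  have bdd: "bdd_above (score atom w ` \<Lambda>)" for w
    using score_le_norm by (auto intro!: bdd_aboveI[of _ "(norm w)\<^sup>2"])
  let ?f = "\<lambda>u. SUP p\<in>\<Lambda>. score atom u p"
  have square: "(greedy_factor atom \<Lambda> S)\<^sup>2 = (INF u\<in>{u \<in> S. norm u = 1}. ?f u)"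
    using assms(3) by (simp add: greedy_factor_def)
  show ?thesis
  proof (cases "u = 0")
    case True
    then show ?thesis by (subst sup) (simp add: score_def)
  next
    case False
    define w where "w = (1 / norm u) *\<^sub>R u"
    have w: "w \<in> S" "norm w = 1" "u = norm u *\<^sub>R w"
      using False assms by (auto simp: w_def subspace_scale)
    have "0 \<le> ?f x" for x
      using p bdd[of x] by (intro cSUP_upper2[of _ _ p]) (auto simp: score_def)
    then have "(INF u\<in>{u \<in> S. norm u = 1}. ?f u) \<le> ?f w"
      using w by (intro cINF_lower bdd_belowI2[of _ 0]) auto
    also have "\<dots> \<le> score atom u p / (norm u)\<^sup>2"
    proof (rule cSUP_least)
      fix q assume "q \<in> \<Lambda>"
      then have "score atom u q \<le> score atom u p" by (rule max)
      moreover have "score atom w q = score atom u q / (norm u)\<^sup>2"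
        by (simp add: score_def w_def power_divide)
      ultimately show "score atom w q \<le> score atom u p / (norm u)\<^sup>2"
        by (simp add: divide_right_mono)
    qed (use p in auto)
    finally show ?thesis
      using False by (simp add: square sup pos_le_divide_eq)
  qed
qed

text \<open>An atom lies in \<open>S\<close>, has norm \<open>1\<close>, and scores at most \<open>1\<close> against every other atom.\<close>
lemma greedy_factor_le_1:
  assumes "subspace S" "atom ` \<Lambda> \<subseteq> S" "0 < greedy_factor atom \<Lambda> S"
  shows "(greedy_factor atom \<Lambda> S)\<^sup>2 \<le> 1"
proof -
  obtain p where p: "p \<in> \<Lambda>" using ex_maximizer by blast
  have "(greedy_factor atom \<Lambda> S)\<^sup>2 * (norm (atom p))\<^sup>2 \<le> (SUP q\<in>\<Lambda>. score atom (atom p) q)"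
    using assms p by (intro greedy_factor_bound) auto
  also have "\<dots> \<le> (norm (atom p))\<^sup>2"
    using p score_le_norm by (intro cSUP_least) auto
  finally show ?thesis using norm_atom[OF p] by simp
qed


section \<open>Decay of the residuals\<close>

lemma gradient_ascent_mono:
  assumes "gradient_ascent atom \<Lambda> u k \<phi>" "k \<in> \<Lambda>"
  shows "\<phi> r \<in> \<Lambda>" "score atom u k \<le> score atom u (\<phi> r)"
proof -
  have "\<phi> r \<in> \<Lambda> \<and> score atom u k \<le> score atom u (\<phi> r)"
  proof (induction r)
    case 0
    then show ?case using assms by (simp add: gradient_ascent_def)
  next
    case (Suc r)
    have "\<phi> (Suc r) = \<phi> r \<or> \<phi> (Suc r) \<in> \<Lambda> \<and> score atom u (\<phi> r) < score atom u (\<phi> (Suc r))"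
      using assms(1) unfolding gradient_ascent_def by metis
    with Suc show ?case by auto
  qed
  then show "\<phi> r \<in> \<Lambda>" "score atom u k \<le> score atom u (\<phi> r)" by auto
qed

lemma norm_residual:
  assumes "q \<in> \<Lambda>"
  shows "(norm (u - (atom q \<bullet> u) *\<^sub>R atom q))\<^sup>2 = (norm u)\<^sup>2 - (atom q \<bullet> u)\<^sup>2"
proof -
  have "atom q \<bullet> atom q = 1" using norm_atom[OF assms] by (simp add: norm_eq_1)
  then show ?thesis
    by (simp add: power2_norm_eq_inner inner_diff inner_commute) (simp add: power2_eq_square)
qed

text \<open>
  The ascent only raises scores, so a lower bound \<open>\<theta>\<close> for the best score over the starting points
  also holds for the best score over the points reached, whatever the numbers of steps. Each
  iteration therefore removes at least the fraction \<open>\<alpha>\<^sup>2 \<theta>\<close> of the squared norm. The bound \<open>\<alpha>\<^sup>2 \<theta> \<le> 1\<close>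
  makes the square root nonnegative, so that the factors can be multiplied.
\<close>
lemma gMP_decay:
  assumes S: "subspace S" "atom ` \<Lambda> \<subseteq> S" and sub: "\<Lambda>\<^sub>d \<subseteq> \<Lambda>"
    and \<theta>: "\<And>u. u \<in> S \<Longrightarrow> \<theta> * (norm u)\<^sup>2 \<le> (SUP k\<in>\<Lambda>\<^sub>d. score atom u k)"
    and \<alpha>: "\<alpha>\<^sup>2 * \<theta> \<le> 1"
    and "f \<in> S" and gMP: "gMP atom \<Lambda> \<Lambda>\<^sub>d \<kappa> \<alpha> f R"
  shows "norm (R m) \<le> sqrt (1 - \<alpha>\<^sup>2 * \<theta>) ^ m * norm f"
proof -
  have "R m \<in> S \<and> norm (R m) \<le> sqrt (1 - \<alpha>\<^sup>2 * \<theta>) ^ m * norm f"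
  proof (induction m)
    case 0
    then show ?case using gMP \<open>f \<in> S\<close> by (simp add: gMP_def)
  next
    case (Suc m)
    let ?u = "R m"
    from gMP have "\<exists>\<phi>. (\<forall>k\<in>\<Lambda>\<^sub>d. gradient_ascent atom \<Lambda> ?u k (\<phi> k)) \<and>
        (\<exists>k\<in>\<Lambda>\<^sub>d. \<alpha>\<^sup>2 * (SUP k\<in>\<Lambda>\<^sub>d. score atom ?u (\<phi> k (\<kappa> m))) \<le> (atom (\<phi> k (\<kappa> m)) \<bullet> ?u)\<^sup>2 \<and>
          R (Suc m) = ?u - (atom (\<phi> k (\<kappa> m)) \<bullet> ?u) *\<^sub>R atom (\<phi> k (\<kappa> m)))"
      unfolding gMP_def score_def bex_simps(7) by (elim conjE) (erule spec)
    then obtain \<phi> k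
      where \<phi>: "\<And>k. k \<in> \<Lambda>\<^sub>d \<Longrightarrow> gradient_ascent atom \<Lambda> ?u k (\<phi> k)" and k: "k \<in> \<Lambda>\<^sub>d"
        and select: "\<alpha>\<^sup>2 * (SUP k\<in>\<Lambda>\<^sub>d. score atom ?u (\<phi> k (\<kappa> m))) \<le> (atom (\<phi> k (\<kappa> m)) \<bullet> ?u)\<^sup>2"
        and step: "R (Suc m) = ?u - (atom (\<phi> k (\<kappa> m)) \<bullet> ?u) *\<^sub>R atom (\<phi> k (\<kappa> m))"
      by blast
    let ?\<nu> = "\<phi> k (\<kappa> m)"
    have ascent: "\<phi> j (\<kappa> m) \<in> \<Lambda>" "score atom ?u j \<le> score atom ?u (\<phi> j (\<kappa> m))"
      if "j \<in> \<Lambda>\<^sub>d" for j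
      using gradient_ascent_mono[OF \<phi>[OF that]] that sub by auto
    have "(SUP k\<in>\<Lambda>\<^sub>d. score atom ?u k) \<le> (SUP k\<in>\<Lambda>\<^sub>d. score atom ?u (\<phi> k (\<kappa> m)))"
    proof (rule cSUP_mono)
      show "bdd_above ((\<lambda>k. score atom ?u (\<phi> k (\<kappa> m))) ` \<Lambda>\<^sub>d)"
        using ascent score_le_norm by (auto intro!: bdd_aboveI[of _ "(norm ?u)\<^sup>2"])
    qed (use k ascent in auto)
    then have "\<theta> * (norm ?u)\<^sup>2 \<le> (SUP k\<in>\<Lambda>\<^sub>d. score atom ?u (\<phi> k (\<kappa> m)))"
      using \<theta>[of ?u] Suc by auto
    then have "\<alpha>\<^sup>2 * (\<theta> * (norm ?u)\<^sup>2) \<le> (atom ?\<nu> \<bullet> ?u)\<^sup>2"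
      using select by (meson mult_left_mono order_trans zero_le_power2)
    then have "(norm (R (Suc m)))\<^sup>2 \<le> (1 - \<alpha>\<^sup>2 * \<theta>) * (norm ?u)\<^sup>2"
      using ascent(1)[OF k] by (simp add: step norm_residual algebra_simps)
    then have "norm (R (Suc m)) \<le> sqrt (1 - \<alpha>\<^sup>2 * \<theta>) * norm ?u"
      using real_le_rsqrt by (fastforce simp: real_sqrt_mult)
    also have "\<dots> \<le> sqrt (1 - \<alpha>\<^sup>2 * \<theta>) * (sqrt (1 - \<alpha>\<^sup>2 * \<theta>) ^ m * norm f)"
      using Suc \<alpha> by (intro mult_left_mono) auto
    finally have "norm (R (Suc m)) \<le> sqrt (1 - \<alpha>\<^sup>2 * \<theta>) ^ Suc m * norm f"
      by (simp add: mult.assoc)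
    moreover have "R (Suc m) \<in> S"
      using Suc ascent(1)[OF k] S unfolding step
      by (intro subspace_diff subspace_scale) auto
    ultimately show ?case by blast
  qed
  then show ?thesis ..
qed

end


section \<open>The rate of the optimized discrete pursuit\<close>

theorem theorem2:
  fixes M :: "'x measure"
    and cls :: "('x \<Rightarrow> real) \<Rightarrow> 'h::{real_inner, complete_space}"
    and \<Lambda> \<Lambda>\<^sub>d :: "(real^'n::finite) set"
    and U :: "real^'n \<Rightarrow> 'h \<Rightarrow> 'h"
    and g :: 'h
    and atom :: "real^'n \<Rightarrow> 'h"
    and S :: "'h set"
    and \<alpha> \<alpha>'' \<beta> K \<rho> :: real
  assumes dict: "parametric_dictionary M cls \<Lambda> U g atom"
    and S: "subspace S" "closed S" "atom ` \<Lambda> \<subseteq> S"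
    and \<beta>: "\<beta> = greedy_factor atom \<Lambda> S" "\<beta> > 0"
    and cond: "condition_number atom \<Lambda> \<noteq> 0"
    and K: "K = enn2real (max_curvature atom \<Lambda>)"
    and \<Lambda>\<^sub>d: "\<Lambda>\<^sub>d \<subseteq> \<Lambda>" "countable \<Lambda>\<^sub>d"
    and dense: "density_radius atom \<Lambda> \<Lambda>\<^sub>d < ennreal (\<beta> / sqrt (1 + K))"
    and \<rho>: "\<rho> = enn2real (density_radius atom \<Lambda> \<Lambda>\<^sub>d)"
    and \<alpha>: "0 < \<alpha>" "\<alpha> \<le> 1"
    and \<alpha>'': "\<alpha>'' = \<alpha> * sqrt (1 - 1/2 * inverse (\<beta>\<^sup>2) * \<rho>\<^sup>2 * (1 + K))"
  shows "(\<exists>\<kappa> :: nat \<Rightarrow> nat. (\<forall>m. \<kappa> m > 0) \<and>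
            (\<forall>f\<in>S. \<forall>R. gMP atom \<Lambda> \<Lambda>\<^sub>d \<kappa> \<alpha> f R \<longrightarrow>
               (\<forall>m. norm (R m) \<le> cMP_rate \<alpha>'' \<beta> m * norm f)))
         \<and> \<alpha>'' \<le> \<alpha>"
proof -
  interpret parametric_dictionary M cls \<Lambda> U g atom by (rule dict)
  have curvature: "max_curvature atom \<Lambda> = ennreal K" and K0: "0 \<le> K"
    using cond K by (auto simp: condition_number_def top.not_eq_extremum)
  have radius: "density_radius atom \<Lambda> \<Lambda>\<^sub>d = ennreal \<rho>" and \<rho>0: "0 \<le> \<rho>"
    using less_trans[OF dense ennreal_less_top] \<rho> by auto
  have "\<rho> < \<beta> / sqrt (1 + K)"
    using dense \<rho>0 unfolding radius by (simp add: ennreal_less_iff)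
  then have "(\<rho> * sqrt (1 + K))\<^sup>2 < \<beta>\<^sup>2"
    using K0 \<rho>0 by (intro power_strict_mono) (auto simp: field_simps)
  then have \<rho>K: "\<rho>\<^sup>2 * (1 + K) < \<beta>\<^sup>2"
    using K0 by (simp add: power_mult_distrib)
  define \<theta> where "\<theta> = \<beta>\<^sup>2 - \<rho>\<^sup>2 * (1 + K) / 2"
  define \<eta> where "\<eta> = 1 - 1/2 * inverse (\<beta>\<^sup>2) * \<rho>\<^sup>2 * (1 + K)"
  have \<theta>: "\<theta> = \<eta> * \<beta>\<^sup>2"
    using \<beta>(2) by (simp add: \<theta>_def \<eta>_def field_simps)
  have "0 \<le> \<rho>\<^sup>2 * (1 + K)" "0 < \<beta>\<^sup>2" "\<beta>\<^sup>2 \<le> 1"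
    using K0 \<beta> greedy_factor_le_1[OF S(1,3)] by auto
  then have \<theta>0: "0 < \<theta>" and \<theta>1: "\<theta> \<le> 1"
    using \<rho>K unfolding \<theta>_def by linarith+
  have \<eta>: "0 \<le> \<eta>" "\<eta> \<le> 1"
    using \<theta>0 \<beta>(2) K0 unfolding \<theta> by (auto simp: zero_less_mult_iff \<eta>_def)
  have weakness: "\<alpha>'' = \<alpha> * sqrt \<eta>"
    by (simp only: \<alpha>'' \<eta>_def)
  have rate: "\<alpha>''\<^sup>2 * \<beta>\<^sup>2 = \<alpha>\<^sup>2 * \<theta>"
    using \<eta> by (simp add: weakness \<theta> power_mult_distrib)
  have discrete: "\<theta> * (norm u)\<^sup>2 \<le> (SUP k\<in>\<Lambda>\<^sub>d. score atom u k)" if "u \<in> S" for u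
    using discrete_score_lower_bound[OF \<Lambda>\<^sub>d(1) _ \<rho>0 _ K0, of u]
      greedy_factor_bound[OF S(1) that] \<beta>
    by (simp add: curvature radius \<theta>_def algebra_simps)
  have "\<alpha>\<^sup>2 * \<theta> \<le> 1"
    using \<alpha> \<theta>0 \<theta>1 by (simp add: mult_le_one power_le_one)
  then have "norm (R m) \<le> cMP_rate \<alpha>'' \<beta> m * norm f"
    if "f \<in> S" "gMP atom \<Lambda> \<Lambda>\<^sub>d (\<lambda>_. 1) \<alpha> f R" for f R m
    unfolding cMP_rate_def rate by (intro gMP_decay[OF S(1,3) \<Lambda>\<^sub>d(1) discrete _ that])
  moreover have "\<alpha>'' \<le> \<alpha>"
    using \<alpha>(1) \<eta> by (simp add: weakness)
  ultimately show ?thesis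
    by (intro conjI exI[of _ "\<lambda>_. 1"]) auto
qed

end
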